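(* Let $F$ be a graph with at least two vertices and let $r\ge 2$ be an integer, and set $k=\min\{r-1,|V(F)|-1\}$. Then, as $n\to\infty$, $$\mathrm{ex}_r(n,\text{Berge-}F)\le (|E(F)|-1)\,\mathrm{ex}(n,K_3,F)+\mathrm{ex}(n,K_r,F)+\frac{(|E(F)|-1)\,\mathrm{ex}(n,F)}{k(r-k)}+o(n^2).$$
   Context: For a graph $F$ and a hypergraph $\mathcal H$, $\mathcal H$ contains a Berge copy of $F$ (a Berge-$F$) if there is an injection $\varphi:V(F)\to V(\mathcal H)$ and an injection $f:E(F)\to E(\mathcal H)$ such that for every edge $xy\in E(F)$, $\{\varphi(x),\varphi(y)\}\subseteq f(xy)$. $\mathrm{ex}_r(n,\text{Berge-}F)$ denotes the maximum number of hyperedges in an $n$-vertex $r$-uniform hypergraph containing no Berge-$F$. $\mathrm{ex}(n,F)$ is the maximum number of edges of an $n$-vertex graph containing no subgraph isomorphic to $F$, and for a graph $H$, $\mathrm{ex}(n,H,F)$ is the maximum number of (not necessarily induced) copies of $H$ in an $n$-vertex graph containing no copy of $F$. *)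

theory Defs
  imports Main "HOL-Library.Landau_Symbols"
begin

definition is_graph :: "'a set \<Rightarrow> 'a set set \<Rightarrow> bool" where
  "is_graph V E \<longleftrightarrow> finite V \<and> (\<forall>e\<in>E. e \<subseteq> V \<and> card e = 2)"

definition contains_copy :: "'b set \<Rightarrow> 'b set set \<Rightarrow> 'a set \<Rightarrow> 'a set set \<Rightarrow> bool" where
  "contains_copy V E VF EF \<longleftrightarrow>
     (\<exists>\<phi>. inj_on \<phi> VF \<and> \<phi> ` VF \<subseteq> V \<and> (\<forall>e\<in>EF. \<phi> ` e \<in> E))"

definition graph_iso :: "'a set \<Rightarrow> 'a set set \<Rightarrow> 'b set \<Rightarrow> 'b set set \<Rightarrow> bool" where
  "graph_iso VH EH V' E' \<longleftrightarrow> (\<exists>g. bij_betw g VH V' \<and> (\<lambda>e. g ` e) ` EH = E')"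

definition num_copies :: "'a set \<Rightarrow> 'a set set \<Rightarrow> 'b set \<Rightarrow> 'b set set \<Rightarrow> nat" where
  "num_copies VH EH V E =
     card {(V', E'). V' \<subseteq> V \<and> E' \<subseteq> E \<and> (\<forall>e\<in>E'. e \<subseteq> V') \<and> graph_iso VH EH V' E'}"

definition K_vert :: "nat \<Rightarrow> nat set" where "K_vert m = {0..<m}"
definition K_edges :: "nat \<Rightarrow> nat set set" where
  "K_edges m = {e. e \<subseteq> {0..<m} \<and> card e = 2}"

text \<open>F-free graphs on the vertex set {0..<n}.  (Maxima are taken over a set
  augmented by 0; this only matters in the degenerate case where no F-free
  host exists, e.g. F edgeless.)\<close>
definition F_free :: "nat \<Rightarrow> 'a set \<Rightarrow> 'a set set \<Rightarrow> nat set set \<Rightarrow> bool" where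
  "F_free n VF EF E \<longleftrightarrow> is_graph {0..<n} E \<and> \<not> contains_copy {0..<n} E VF EF"

definition ex :: "nat \<Rightarrow> 'a set \<Rightarrow> 'a set set \<Rightarrow> nat" where
  "ex n VF EF = Max (insert 0 {card E | E. F_free n VF EF E})"

definition ex_gen :: "nat \<Rightarrow> 'b set \<Rightarrow> 'b set set \<Rightarrow> 'a set \<Rightarrow> 'a set set \<Rightarrow> nat" where
  "ex_gen n VH EH VF EF = Max (insert 0 {num_copies VH EH {0..<n} E | E. F_free n VF EF E})"

definition uniform_hypergraph :: "nat \<Rightarrow> nat \<Rightarrow> nat set set \<Rightarrow> bool" where
  "uniform_hypergraph r n H \<longleftrightarrow> (\<forall>h\<in>H. h \<subseteq> {0..<n} \<and> card h = r)"

definition contains_berge :: "'b set \<Rightarrow> 'b set set \<Rightarrow> 'a set \<Rightarrow> 'a set set \<Rightarrow> bool" where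
  "contains_berge V H VF EF \<longleftrightarrow>
     (\<exists>\<phi> f. inj_on \<phi> VF \<and> \<phi> ` VF \<subseteq> V \<and> inj_on f EF \<and> f ` EF \<subseteq> H \<and>
            (\<forall>e\<in>EF. \<phi> ` e \<subseteq> f e))"

definition ex_berge :: "nat \<Rightarrow> nat \<Rightarrow> 'a set \<Rightarrow> 'a set set \<Rightarrow> nat" where
  "ex_berge r n VF EF = Max (insert 0 {card H | H. uniform_hypergraph r n H \<and>
                                    \<not> contains_berge {0..<n} H VF EF})"

end

theory Submission
  imports Defs
begin

text \<open>Let \<open>q = |E(F)|\<close> and call a pair of vertices heavy if it lies in at least \<open>q\<close> hyperedges, light
  if it lies in fewer but at least one. A graph made of heavy pairs and of light pairs with
  distinct representing hyperedges is \<open>F\<close>-free. Hyperedges with only heavy pairs are \<open>r\<close>-cliques of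
  the heavy graph. If a hyperedge has a light pair whose ends have a common heavy neighbour in it,
  adding that pair to the heavy graph creates a new triangle. In every other hyperedge the heavy
  graph is a disjoint union of at least two cliques of size at most \<open>k\<close>, which leaves at least
  \<open>k(r - k)\<close> light pairs. Each light pair lies in at most \<open>q - 1\<close> hyperedges, so it remains to see
  that there are at most \<open>ex(n,F) + o(n\<^sup>2)\<close> light pairs: assign to each a hyperedge containing it; on
  almost every vertex set of bounded size \<open>m\<close> this assignment is injective, so at most \<open>ex(m,F)\<close>
  light pairs lie there, and averaging compares the densities.\<close>

section \<open>Counting\<close>

lemma double_counting:
  assumes "finite A" "finite B"
    and "\<And>a. a \<in> A \<Longrightarrow> s \<le> card {b \<in> B. R a b}"
    and "\<And>b. b \<in> B \<Longrightarrow> card {a \<in> A. R a b} \<le> (d :: nat)"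
  shows "s * card A \<le> d * card B"
proof -
  have "s * card A = (\<Sum>a\<in>A. s)" by simp
  also have "\<dots> \<le> (\<Sum>a\<in>A. card {b \<in> B. R a b})" by (intro sum_mono assms)
  also have "\<dots> = (\<Sum>a\<in>A. \<Sum>b\<in>{b \<in> B. R a b}. 1)" by simp
  also have "\<dots> = (\<Sum>b\<in>B. \<Sum>a\<in>{a \<in> A. R a b}. 1)"
    using assms(1,2) by (rule sum.swap_restrict)
  also have "\<dots> = (\<Sum>b\<in>B. card {a \<in> A. R a b})" by simp
  also have "\<dots> \<le> (\<Sum>b\<in>B. d)" by (intro sum_mono assms)
  finally show ?thesis by (simp add: mult.commute)
qed

lemma card_supersets:
  assumes "finite V" "T \<subseteq> V" "card T \<le> m"
  shows "card {M. T \<subseteq> M \<and> M \<subseteq> V \<and> card M = m} = (card V - card T) choose (m - card T)"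
proof -
  have fT: "finite T" using assms finite_subset by blast
  have "bij_betw (\<lambda>M. M - T) {M. T \<subseteq> M \<and> M \<subseteq> V \<and> card M = m}
          {M. M \<subseteq> V - T \<and> card M = m - card T}"
  proof (rule bij_betw_byWitness[where f' = "\<lambda>M. M \<union> T"])
    show "(\<lambda>M. M \<union> T) ` {M. M \<subseteq> V - T \<and> card M = m - card T}
            \<subseteq> {M. T \<subseteq> M \<and> M \<subseteq> V \<and> card M = m}"
    proof (clarify, intro conjI)
      fix M assume M: "M \<subseteq> V - T" "card M = m - card T"
      then have "finite M" using assms(1) finite_subset by blast
      then have "card (M \<union> T) = card M + card T"
        using M fT by (intro card_Un_disjoint) auto
      then show "card (M \<union> T) = m" using M assms(3) by simp
    qed (use assms(2) in auto)
  qed (use fT in \<open>auto simp: card_Diff_subset\<close>)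
  then have "card {M. T \<subseteq> M \<and> M \<subseteq> V \<and> card M = m} = card {M. M \<subseteq> V - T \<and> card M = m - card T}"
    by (rule bij_betw_same_card)
  also have "\<dots> = card (V - T) choose (m - card T)"
    using assms(1) by (intro n_subsets) auto
  finally show ?thesis using assms fT by (simp add: card_Diff_subset)
qed

text \<open>Each chosen value joins the forbidden set \<open>U\<close>, so \<open>card U\<close>
  grows by one as \<open>card X\<close> drops by one and the size hypothesis survives the
  induction.\<close>

lemma greedy_representatives:
  assumes "finite X" "finite U"
    and "\<And>x. x \<in> X \<Longrightarrow> card X + card U \<le> card (A x)"
  shows "\<exists>f. inj_on f X \<and> (\<forall>x\<in>X. f x \<in> A x - U)"
  using assms
proof (induction X arbitrary: U rule: finite_induct)
  case (insert x X)
  have "card U < card (A x)" using insert.prems(2)[of x] insert.hyps by simp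
  then obtain a where a: "a \<in> A x" "a \<notin> U"
    using insert.prems(1) by (metis card_mono linorder_not_le subsetI)
  have "\<exists>f. inj_on f X \<and> (\<forall>y\<in>X. f y \<in> A y - insert a U)"
    by (rule insert.IH) (use insert a in auto)
  then obtain f where f: "inj_on f X" "\<forall>y\<in>X. f y \<in> A y - insert a U" by blast
  then have "inj_on (f(x := a)) (insert x X)"
    using insert.hyps by (auto simp: inj_on_def)
  moreover have "\<forall>y\<in>insert x X. (f(x := a)) y \<in> A y - U" using f a by auto
  ultimately show ?case by blast
qed simp

text \<open>Each unordered pair arises in two orders; this converts a degree sum over
  \<open>h\<close> into a count of pairs.\<close>

lemma card_ordered_pairs:
  assumes "finite h"
  shows "card {(u, v). u \<in> h \<and> v \<in> h \<and> u \<noteq> v \<and> {u, v} \<in> L}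
    = 2 * card {e \<in> L. e \<subseteq> h \<and> card e = 2}"
proof -
  let ?U = "{e \<in> L. e \<subseteq> h \<and> card e = 2}"
  have fU: "finite ?U" using assms by (auto intro: finite_subset[of _ "Pow h"])
  have "{(u, v). u \<in> h \<and> v \<in> h \<and> u \<noteq> v \<and> {u, v} \<in> L} = (\<Union>e\<in>?U. {(u, v). u \<noteq> v \<and> {u, v} = e})"
    by auto
  moreover have two: "finite {(u, v). u \<noteq> v \<and> {u, v} = e} \<and> card {(u, v). u \<noteq> v \<and> {u, v} = e} = 2"
    if "e \<in> ?U" for e
  proof -
    obtain a b where ab: "e = {a, b}" "a \<noteq> b" using \<open>e \<in> ?U\<close> by (auto simp: card_2_iff)
    then have "{(u, v). u \<noteq> v \<and> {u, v} = e} = {(a, b), (b, a)}" by (auto simp: doubleton_eq_iff)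
    then show ?thesis using ab by simp
  qed
  moreover have "card (\<Union>e\<in>?U. {(u, v). u \<noteq> v \<and> {u, v} = e})
      = (\<Sum>e\<in>?U. card {(u, v). u \<noteq> v \<and> {u, v} = e})"
    using fU two by (intro card_UN_disjoint) auto
  ultimately show ?thesis by simp
qed

text \<open>If no vertex class exceeds half of \<open>h\<close>, the degree sum already gives \<open>r\<^sup>2 / 4\<close> pairs;
  otherwise the pairs leaving a large class suffice.\<close>

lemma card_pairs_outside_classes:
  assumes h: "finite h" "card h = r" and "k \<le> r"
    and trans: "\<And>u v w. u \<in> h \<Longrightarrow> v \<in> h \<Longrightarrow> w \<in> h \<Longrightarrow> Q u v \<Longrightarrow> Q v w \<Longrightarrow> Q u w"
    and refl: "\<And>u. u \<in> h \<Longrightarrow> Q u u"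
    and L: "\<And>u v. u \<in> h \<Longrightarrow> v \<in> h \<Longrightarrow> \<not> Q u v \<Longrightarrow> {u, v} \<in> L"
    and small: "\<And>u. u \<in> h \<Longrightarrow> card {v \<in> h. Q u v} \<le> k"
  shows "k * (r - k) \<le> card {e \<in> L. e \<subseteq> h \<and> card e = 2}"
proof (cases "\<exists>u\<in>h. r < 2 * card {v \<in> h. Q u v}")
  case True
  then obtain u where u: "u \<in> h" "r < 2 * card {v \<in> h. Q u v}" by blast
  define A where "A = {v \<in> h. Q u v}"
  have A: "A \<subseteq> h" "finite A" "card A \<le> k" "r < 2 * card A"
    using u small h by (auto simp: A_def)
  \<comment> \<open>The function \<open>x * (r - x)\<close> decreases beyond \<open>r / 2\<close>,
    and \<open>r / 2 < card A \<le> k\<close>. The product of differences below is this monotonicity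
    in factored form.\<close>
  have "k * (r - k) \<le> card A * (r - card A)"
  proof -
    have "0 \<le> (int k - int (card A)) * (int k + int (card A) - int r)"
      using A by (intro mult_nonneg_nonneg) auto
    then have "int k * (int r - int k) \<le> int (card A) * (int r - int (card A))"
      by (simp add: algebra_simps)
    then have "int (k * (r - k)) \<le> int (card A * (r - card A))"
      using A \<open>k \<le> r\<close> by (simp add: of_nat_diff)
    then show ?thesis by linarith
  qed
  also have "\<dots> = card (A \<times> (h - A))"
    using A h by (simp add: card_cartesian_product card_Diff_subset)
  also have "\<dots> \<le> card {e \<in> L. e \<subseteq> h \<and> card e = 2}"
  proof (rule card_inj_on_le[where f = "\<lambda>(a, b). {a, b}"])
    show "inj_on (\<lambda>(a, b). {a, b}) (A \<times> (h - A))"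
      by (auto simp: inj_on_def doubleton_eq_iff)
    have "{a, b} \<in> L \<and> a \<noteq> b" if ab: "a \<in> A" "b \<in> h - A" for a b
    proof -
      have "\<not> Q a b" using ab trans[of u a b] u by (auto simp: A_def)
      then show ?thesis using L[of a b] ab A by auto
    qed
    then show "(\<lambda>(a, b). {a, b}) ` (A \<times> (h - A)) \<subseteq> {e \<in> L. e \<subseteq> h \<and> card e = 2}"
      using A by auto
    show "finite {e \<in> L. e \<subseteq> h \<and> card e = 2}"
      using h by (auto intro: finite_subset[of _ "Pow h"])
  qed
  finally show ?thesis .
next
  case False
  let ?O = "{(u, v). u \<in> h \<and> v \<in> h \<and> u \<noteq> v \<and> {u, v} \<in> L}"
  have fin: "finite ?O" using h by (auto intro: finite_subset[of _ "h \<times> h"])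
  have "r * r = (\<Sum>u\<in>h. r)" using h by simp
  also have "\<dots> \<le> (\<Sum>u\<in>h. 2 * card {v \<in> h. \<not> Q u v})"
  proof (rule sum_mono)
    fix u assume "u \<in> h"
    have "{v \<in> h. \<not> Q u v} = h - {v \<in> h. Q u v}" by auto
    then have "card {v \<in> h. \<not> Q u v} = r - card {v \<in> h. Q u v}"
      using h by (simp add: card_Diff_subset)
    then show "r \<le> 2 * card {v \<in> h. \<not> Q u v}" using False \<open>u \<in> h\<close> by force
  qed
  also have "\<dots> = 2 * card (SIGMA u:h. {v \<in> h. \<not> Q u v})"
    using h by (simp add: card_SigmaI sum_distrib_left)
  also have "\<dots> \<le> 2 * card ?O"
    using L refl fin by (intro mult_le_mono2 card_mono) auto
  also have "\<dots> = 4 * card {e \<in> L. e \<subseteq> h \<and> card e = 2}"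
    using card_ordered_pairs[OF h(1), of L] by simp
  finally have "r * r \<le> 4 * card {e \<in> L. e \<subseteq> h \<and> card e = 2}" .
  moreover have "4 * (k * (r - k)) \<le> r * r"
  proof -
    obtain j where "r = k + j" using \<open>k \<le> r\<close> le_iff_add by auto
    moreover have "4 * (k * j) \<le> (k + j) * (k + j)"
    proof -
      have "0 \<le> (int k - int j)\<^sup>2" by simp
      then have "int (4 * (k * j)) \<le> int ((k + j) * (k + j))"
        by (simp add: power2_eq_square algebra_simps)
      then show ?thesis by linarith
    qed
    ultimately show ?thesis by simp
  qed
  ultimately show ?thesis by linarith
qed

section \<open>Averaging over small vertex sets\<close>

text \<open>Sampling an \<open>m\<close>-set: two edges of the same colour span at least three vertices, so only a
  fraction \<open>O(1/n)\<close> of the \<open>m\<close>-sets contain such a pair, and the others carry at most \<open>x\<close> edges.\<close>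

lemma card_le_of_rainbow_samples:
  fixes L :: "'v set set" and c :: "'v set \<Rightarrow> 'v set"
  assumes V: "finite V" "card V = n" and m: "3 \<le> m" "m \<le> n"
    and L: "\<And>e. e \<in> L \<Longrightarrow> e \<subseteq> V \<and> card e = 2 \<and> e \<subseteq> c e \<and> finite (c e) \<and> card (c e) = r"
    and rainbow: "\<And>M. M \<subseteq> V \<Longrightarrow> card M = m \<Longrightarrow> inj_on c {e \<in> L. e \<subseteq> M} \<Longrightarrow>
      card {e \<in> L. e \<subseteq> M} \<le> x"
  shows "real (card L) \<le> real x / (real m * (real m - 1)) * (real n * (real n - 1))
    + 3 * real (m choose 2) * real (r choose 2) * real m * real n"
proof -
  let ?Ms = "{M. M \<subseteq> V \<and> card M = m}"
  let ?K = "{(e, e'). e \<in> L \<and> e' \<in> L \<and> e \<noteq> e' \<and> c e = c e'}"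
  let ?bad = "{M \<in> ?Ms. \<not> inj_on c {e \<in> L. e \<subseteq> M}}"
  have "L \<subseteq> Pow V" using L by blast
  then have fL: "finite L" using V finite_subset by blast
  have fMs: "finite ?Ms" using V by simp
  have fK: "finite ?K" using fL by (intro finite_subset[of ?K "L \<times> L"]) auto
  have cardL: "card L \<le> n choose 2"
    using card_mono[of "{e. e \<subseteq> V \<and> card e = 2}" L] L V by (auto simp: n_subsets)

  \<comment> \<open>A partner \<open>e'\<close> of \<open>e\<close> lies in
    \<open>c e' = c e\<close>, a set of \<open>r\<close> elements.\<close>
  have cK: "card ?K \<le> (r choose 2) * card L"
  proof -
    have "?K \<subseteq> (SIGMA e:L. {e'. e' \<subseteq> c e \<and> card e' = 2})"
    proof
      fix p assume "p \<in> ?K"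
      then obtain e e' where "p = (e, e')" "e \<in> L" "e' \<in> L" "c e = c e'" by auto
      then show "p \<in> (SIGMA e:L. {e'. e' \<subseteq> c e \<and> card e' = 2})" using L[of e'] by simp
    qed
    moreover have "finite (SIGMA e:L. {e'. e' \<subseteq> c e \<and> card e' = 2})"
      using fL L by (intro finite_SigmaI) auto
    ultimately have "card ?K \<le> card (SIGMA e:L. {e'. e' \<subseteq> c e \<and> card e' = 2})"
      by (intro card_mono)
    also have "\<dots> = (\<Sum>e\<in>L. card {e'. e' \<subseteq> c e \<and> card e' = 2})"
      using fL L by (intro card_SigmaI) auto
    also have "\<dots> = (\<Sum>e\<in>L. r choose 2)"
      using L by (intro sum.cong) (auto simp: n_subsets)
    finally show ?thesis by (simp add: mult.commute)
  qed

  have cbad: "card ?bad \<le> card ?K * ((n - 3) choose (m - 3))"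
  proof -
    have "?bad \<subseteq> (\<Union>p\<in>?K. {M \<in> ?Ms. fst p \<union> snd p \<subseteq> M})"
    proof
      fix M assume M: "M \<in> ?bad"
      then obtain e e' where "e \<in> L" "e \<subseteq> M" "e' \<in> L" "e' \<subseteq> M" "c e = c e'" "e \<noteq> e'"
        unfolding inj_on_def by blast
      then show "M \<in> (\<Union>p\<in>?K. {M \<in> ?Ms. fst p \<union> snd p \<subseteq> M})"
        using M by (intro UN_I[of "(e, e')"]) simp_all
    qed
    then have "card ?bad \<le> card (\<Union>p\<in>?K. {M \<in> ?Ms. fst p \<union> snd p \<subseteq> M})"
    proof (rule card_mono[rotated])
      have "finite {M \<in> ?Ms. T \<subseteq> M}" for T by (rule finite_subset[OF _ fMs]) blast
      then show "finite (\<Union>p\<in>?K. {M \<in> ?Ms. fst p \<union> snd p \<subseteq> M})" using fK by (intro finite_UN_I)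
    qed
    also have "\<dots> \<le> (\<Sum>p\<in>?K. card {M \<in> ?Ms. fst p \<union> snd p \<subseteq> M})"
      using fK by (rule card_UN_le)
    also have "\<dots> \<le> (\<Sum>p\<in>?K. (n - 3) choose (m - 3))"
    proof (rule sum_mono)
      fix p assume "p \<in> ?K"
      then obtain e e' where p: "p = (e, e')" "e \<in> L" "e' \<in> L" "e \<noteq> e'" by auto
      have fin: "finite e" "finite e'" using p L V by (meson finite_subset)+
      \<comment> \<open>Distinct sets of equal size: \<open>e'\<close> has a vertex outside
        \<open>e\<close>, so the union contains a three-element set \<open>T\<close>, whose
        supersets are easy to count.\<close>
      have "\<not> e' \<subseteq> e"
        using p fin L by (metis card_subset_eq)
      then obtain y where y: "y \<in> e'" "y \<notin> e" by blast
      define T where "T = insert y e"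
      have T: "T \<subseteq> V" "card T = 3" "T \<subseteq> e \<union> e'"
        using L[of e] L[of e'] p y fin by (auto simp: T_def)
      have "card {M \<in> ?Ms. fst p \<union> snd p \<subseteq> M} \<le> card {M. T \<subseteq> M \<and> M \<subseteq> V \<and> card M = m}"
        using T p V by (intro card_mono) auto
      also have "\<dots> = (n - 3) choose (m - 3)"
        using card_supersets[of V T m] T V m by simp
      finally show "card {M \<in> ?Ms. fst p \<union> snd p \<subseteq> M} \<le> (n - 3) choose (m - 3)" .
    qed
    finally show ?thesis by simp
  qed

  \<comment> \<open>Pairs of an edge and a sample containing it are counted in two ways. A bad
    sample is allowed the trivial bound \<open>m choose 2\<close> in addition to
    \<open>x\<close>.\<close>
  have "card L * ((n - 2) choose (m - 2)) = (\<Sum>e\<in>L. card {M. e \<subseteq> M \<and> M \<subseteq> V \<and> card M = m})"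
    using L V m by (simp add: card_supersets)
  also have "\<dots> = (\<Sum>e\<in>L. \<Sum>M\<in>{M \<in> ?Ms. e \<subseteq> M}. 1)"
    by (intro sum.cong refl) (simp add: conj_ac)
  also have "\<dots> = (\<Sum>M\<in>?Ms. \<Sum>e\<in>{e \<in> L. e \<subseteq> M}. 1)"
    using fL fMs by (rule sum.swap_restrict)
  also have "\<dots> = (\<Sum>M\<in>?Ms. card {e \<in> L. e \<subseteq> M})" by simp
  also have "\<dots> \<le> (\<Sum>M\<in>?Ms. x + (if M \<in> ?bad then m choose 2 else 0))"
  proof (rule sum_mono)
    fix M assume M: "M \<in> ?Ms"
    then have "finite M" using V finite_subset by blast
    then have "card {e \<in> L. e \<subseteq> M} \<le> card {e. e \<subseteq> M \<and> card e = 2}"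
      using L by (intro card_mono) auto
    also have "\<dots> = m choose 2" using M \<open>finite M\<close> by (simp add: n_subsets)
    finally show "card {e \<in> L. e \<subseteq> M} \<le> x + (if M \<in> ?bad then m choose 2 else 0)"
      using rainbow[of M] M by auto
  qed
  also have "\<dots> = x * (n choose m) + (m choose 2) * card ?bad"
  proof -
    have "(\<Sum>M\<in>?Ms. if M \<in> ?bad then m choose 2 else 0) = (\<Sum>M\<in>?Ms \<inter> ?bad. m choose 2)"
      using sum.inter_restrict[OF fMs, of "\<lambda>_. m choose 2" ?bad] by (rule sym)
    also have "?Ms \<inter> ?bad = ?bad" by auto
    finally have "(\<Sum>M\<in>?Ms. if M \<in> ?bad then m choose 2 else 0) = (m choose 2) * card ?bad" by simp
    then show ?thesis unfolding sum.distrib using V by (simp add: n_subsets)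
  qed
  also have "\<dots> \<le> x * (n choose m) + (m choose 2) * ((r choose 2) * card L * ((n - 3) choose (m - 3)))"
    using cbad cK by (meson add_le_mono le_refl le_trans mult_le_mono)
  finally have main: "card L * ((n - 2) choose (m - 2))
    \<le> x * (n choose m) + (m choose 2) * ((r choose 2) * card L * ((n - 3) choose (m - 3)))" .

  \<comment> \<open>Shifting both parameters by 3 removes truncated subtraction. \<open>X\<close> is
    \<open>(n - 2) choose (m - 2)\<close>, the number of samples over a fixed edge; dividing by it
    turns the counts into densities.\<close>
  obtain n' m' where nm: "n = n' + 3" "m = m' + 3" "m' \<le> n'"
    using m that[of "n - 3" "m - 3"] by simp
  define X where "X = real (Suc n' choose Suc m')"
  have X: "X > 0" using nm by (simp add: X_def del: binomial_Suc_Suc)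
  have b1: "real m * (real m - 1) * real (n choose m) = real n * (real n - 1) * X"
  proof -
    have "Suc (Suc m') * Suc (Suc (Suc m')) * (Suc (Suc (Suc n')) choose Suc (Suc (Suc m')))
      = Suc (Suc n') * Suc (Suc (Suc n')) * (Suc n' choose Suc m')"
      by (metis Suc_times_binomial mult.assoc mult.left_commute)
    then have "real (Suc (Suc m')) * real (Suc (Suc (Suc m'))) * real (Suc (Suc (Suc n')) choose Suc (Suc (Suc m')))
      = real (Suc (Suc n')) * real (Suc (Suc (Suc n'))) * X"
      unfolding X_def by (metis of_nat_mult)
    moreover have "n choose m = Suc (Suc (Suc n')) choose Suc (Suc (Suc m'))"
      unfolding nm by (simp only: numeral_3_eq_3 add_Suc_right add_0_right)
    ultimately show ?thesis using nm by (simp add: algebra_simps del: binomial_Suc_Suc)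
  qed
  have b2: "real ((n - 3) choose (m - 3)) * (real n - 2) = X * (real m - 2)"
  proof -
    have "Suc m' * (Suc n' choose Suc m') = Suc n' * (n' choose m')"
      by (rule Suc_times_binomial)
    then have "real (Suc m') * X = real (Suc n') * real (n' choose m')"
      unfolding X_def by (metis of_nat_mult)
    then show ?thesis using nm by (simp add: algebra_simps del: binomial_Suc_Suc)
  qed
  have m1: "real m * (real m - 1) > 0" and n2: "real n - 2 > 0" using nm by auto
  have e1: "real (n choose m) = real n * (real n - 1) * X / (real m * (real m - 1))"
    using b1 m1 by (metis less_irrefl mult.commute nonzero_eq_divide_eq)
  have e2: "real ((n - 3) choose (m - 3)) = X * (real m - 2) / (real n - 2)"
    using b2 n2 by (simp add: field_simps)
  have "(n - 2) choose (m - 2) = Suc n' choose Suc m'"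
    using nm by (simp del: binomial_Suc_Suc)
  then have "real (card L) * X \<le> real x * real (n choose m)
      + real (m choose 2) * (real (r choose 2) * real (card L) * real ((n - 3) choose (m - 3)))"
    using main unfolding X_def by (metis of_nat_add of_nat_le_iff of_nat_mult)
  also have "\<dots> = (real x / (real m * (real m - 1)) * (real n * (real n - 1))
      + real (m choose 2) * real (r choose 2) * (real m - 2) * (real (card L) / (real n - 2))) * X"
    unfolding e1 e2 by (simp add: distrib_left mult_ac)
  finally have "real (card L) \<le> real x / (real m * (real m - 1)) * (real n * (real n - 1))
      + real (m choose 2) * real (r choose 2) * (real m - 2) * (real (card L) / (real n - 2))"
    using X by (simp only: mult_le_cancel_right_pos)
  also have "real (m choose 2) * real (r choose 2) * (real m - 2) * (real (card L) / (real n - 2))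
    \<le> real (m choose 2) * real (r choose 2) * real m * (3 * real n)"
  proof (intro mult_mono mult_nonneg_nonneg)
    have "even (n * (n - 1))" by (cases n) auto
    then have "2 * (n choose 2) = n * (n - 1)" by (simp only: choose_two dvd_mult_div_cancel)
    then have "2 * card L \<le> n * (n - 1)" using cardL by linarith
    then have "real (2 * card L) \<le> real (n * (n - 1))" by (rule of_nat_mono)
    also have "\<dots> = real n * (real n - 1)" using nm by (simp add: algebra_simps)
    \<comment> \<open>Since \<open>n \<ge> 3\<close>, already
      \<open>n - 1 \<le> 2 * (n - 2)\<close>; the 6, and with it the 3 in the error term, is
      generous.\<close>
    also have "\<dots> \<le> real n * (6 * (real n - 2))"
      using nm by (intro mult_left_mono) auto
    finally show "real (card L) / (real n - 2) \<le> 3 * real n"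
      using n2 by (simp add: field_simps)
  qed (use nm in auto)
  finally show ?thesis by (simp add: mult_ac)
qed

section \<open>Extremal numbers\<close>

lemma finite_F_free: "finite {E. F_free n VF EF E}"
  by (rule finite_subset[of _ "Pow (Pow {0..<n})"]) (auto simp: F_free_def is_graph_def)

lemma card_le_ex: "F_free n VF EF E \<Longrightarrow> card E \<le> ex n VF EF"
  unfolding ex_def by (rule Max_ge) (auto simp: finite_F_free)

lemma num_copies_le_ex_gen: "F_free n VF EF E \<Longrightarrow> num_copies VH EH {0..<n} E \<le> ex_gen n VH EH VF EF"
  unfolding ex_gen_def by (rule Max_ge) (auto simp: finite_F_free)

text \<open>Every enumeration of a clique \<open>t\<close> is an isomorphism onto \<open>t\<close>
  with all its pairs. Pairing \<open>t\<close> with these edges is injective because the first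
  component is kept.\<close>

lemma card_cliques_le_num_copies:
  fixes V :: "'b set"
  assumes "finite V" "finite E"
    and T: "\<And>t. t \<in> T \<Longrightarrow> t \<subseteq> V \<and> card t = m \<and> (\<forall>e. e \<subseteq> t \<and> card e = 2 \<longrightarrow> e \<in> E)"
  shows "card T \<le> num_copies (K_vert m) (K_edges m) V E"
  unfolding num_copies_def
proof (rule card_inj_on_le[where f = "\<lambda>t. (t, {e. e \<subseteq> t \<and> card e = 2})"])
  let ?C = "{(V', E'). V' \<subseteq> V \<and> E' \<subseteq> E \<and> (\<forall>e\<in>E'. e \<subseteq> V') \<and>
    graph_iso (K_vert m) (K_edges m) V' E'}"
  show "(\<lambda>t. (t, {e. e \<subseteq> t \<and> card e = 2})) ` T \<subseteq> ?C"
  proof (rule image_subsetI)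
    fix t assume t: "t \<in> T"
    then have "finite t" using T[OF t] \<open>finite V\<close> finite_subset by blast
    then obtain g where g: "bij_betw g {0..<m} t" using T[OF t] ex_bij_betw_nat_finite[of t] by auto
    have card_g: "card (g ` d) = card d" if "d \<subseteq> {0..<m}" for d
      using that g by (meson bij_betw_def card_image inj_on_subset)
    have "{e. e \<subseteq> t \<and> card e = 2} \<subseteq> (\<lambda>e. g ` e) ` {e. e \<subseteq> {0..<m} \<and> card e = 2}"
    proof
      fix e assume "e \<in> {e. e \<subseteq> t \<and> card e = 2}"
      then have e: "e \<subseteq> g ` {0..<m}" "card e = 2" using g by (auto simp: bij_betw_def)
      then obtain d where d: "d \<subseteq> {0..<m}" "e = g ` d" by (meson subset_imageE)
      then have "d \<in> {e. e \<subseteq> {0..<m} \<and> card e = 2}" using card_g e by simp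
      with d(2) show "e \<in> (\<lambda>e. g ` e) ` {e. e \<subseteq> {0..<m} \<and> card e = 2}" by (rule image_eqI)
    qed
    moreover have "(\<lambda>e. g ` e) ` {e. e \<subseteq> {0..<m} \<and> card e = 2} \<subseteq> {e. e \<subseteq> t \<and> card e = 2}"
    proof (rule image_subsetI)
      fix d assume "d \<in> {e. e \<subseteq> {0..<m} \<and> card e = 2}"
      then have d: "d \<subseteq> {0..<m}" "card d = 2" by auto
      then have "g ` d \<subseteq> g ` {0..<m}" by (intro image_mono)
      then show "g ` d \<in> {e. e \<subseteq> t \<and> card e = 2}" using card_g d g by (simp add: bij_betw_def)
    qed
    ultimately have "(\<lambda>e. g ` e) ` {e. e \<subseteq> {0..<m} \<and> card e = 2} = {e. e \<subseteq> t \<and> card e = 2}"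
      by (rule subset_antisym[rotated])
    then have "graph_iso (K_vert m) (K_edges m) t {e. e \<subseteq> t \<and> card e = 2}"
      using g unfolding graph_iso_def K_vert_def K_edges_def by blast
    moreover have "{e. e \<subseteq> t \<and> card e = 2} \<subseteq> E" using T[OF t] by blast
    ultimately show "(t, {e. e \<subseteq> t \<and> card e = 2}) \<in> ?C" using T[OF t] by simp
  qed
  show "finite ?C"
    by (rule finite_subset[of _ "Pow V \<times> Pow E"]) (use assms(1,2) in auto)
qed (auto simp: inj_on_def)

section \<open>Heavy and light pairs\<close>

locale berge_free_hypergraph =
  fixes VF :: "'a set" and EF :: "'a set set" and n r :: nat and H :: "nat set set"
  assumes graph: "is_graph VF EF"
    and uniform: "uniform_hypergraph r n H"
    and berge_free: "\<not> contains_berge {0..<n} H VF EF"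
begin

definition heavy :: "nat set set" where
  "heavy = {e. e \<subseteq> {0..<n} \<and> card e = 2 \<and> card EF \<le> card {h \<in> H. e \<subseteq> h}}"

definition light :: "nat set set" where
  "light = {e. card e = 2 \<and> e \<notin> heavy \<and> (\<exists>h\<in>H. e \<subseteq> h)}"

lemma hyperedge: "h \<in> H \<Longrightarrow> h \<subseteq> {0..<n} \<and> finite h \<and> card h = r"
  using uniform finite_subset unfolding uniform_hypergraph_def by blast

lemma finite_H: "finite H"
  using hyperedge by (auto intro: finite_subset[of _ "Pow {0..<n}"])

lemma finite_EF: "finite EF"
  using graph by (auto simp: is_graph_def intro: finite_subset[of _ "Pow VF"])

lemma heavy_or_light: "h \<in> H \<Longrightarrow> e \<subseteq> h \<Longrightarrow> card e = 2 \<Longrightarrow> e \<in> heavy \<or> e \<in> light"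
  by (auto simp: light_def)

lemma lightD: "e \<in> light \<Longrightarrow> e \<subseteq> {0..<n} \<and> card e = 2 \<and> card {h \<in> H. e \<subseteq> h} < card EF"
  unfolding light_def heavy_def using hyperedge by fastforce

lemma finite_light: "finite light"
  using lightD by (auto intro: finite_subset[of _ "Pow {0..<n}"])

text \<open>A copy of \<open>F\<close> becomes a Berge copy: pairs in \<open>S\<close> take the hyperedge \<open>c\<close> gives them, and
  the heavy ones are then served greedily.\<close>

lemma no_copy:
  assumes S: "inj_on c S" "\<And>e. e \<in> S \<Longrightarrow> e \<subseteq> c e \<and> c e \<in> H"
  shows "\<not> contains_copy {0..<n} (heavy \<union> S) VF EF"
proof
  assume "contains_copy {0..<n} (heavy \<union> S) VF EF"
  then obtain \<phi> where \<phi>: "inj_on \<phi> VF" "\<phi> ` VF \<subseteq> {0..<n}" "\<forall>e\<in>EF. \<phi> ` e \<in> heavy \<union> S"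
    unfolding contains_copy_def by blast
  define X where "X = {e \<in> EF. \<phi> ` e \<in> S}"
  have inj: "inj_on ((`) \<phi>) EF"
    by (rule inj_on_subset[OF inj_on_image_Pow[OF \<phi>(1)]]) (use graph in \<open>auto simp: is_graph_def\<close>)
  have X: "X \<subseteq> EF" "finite X" using finite_EF by (auto simp: X_def)
  define f1 where "f1 = (\<lambda>e. c (\<phi> ` e))"
  have inj1: "inj_on f1 X"
  proof (rule inj_onI)
    fix e e' assume e: "e \<in> X" "e' \<in> X" "f1 e = f1 e'"
    then have "\<phi> ` e = \<phi> ` e'"
      using inj_onD[OF S(1), of "\<phi> ` e" "\<phi> ` e'"] by (simp add: X_def f1_def)
    then show "e = e'" using e X inj_onD[OF inj, of e e'] by blast
  qed
  \<comment> \<open>The edges still to be served and the hyperedges already taken together number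
    exactly the threshold in \<open>heavy\<close>, as the greedy choice requires.\<close>
  have "card (EF - X) + card (f1 ` X) = card EF"
    using X finite_EF inj1 by (simp add: card_image card_Diff_subset card_mono)
  then have "\<exists>f. inj_on f (EF - X) \<and> (\<forall>e\<in>EF - X. f e \<in> {h \<in> H. \<phi> ` e \<subseteq> h} - f1 ` X)"
    using \<phi>(3) X finite_EF
    by (intro greedy_representatives) (auto simp: X_def heavy_def)
  then obtain f2 where f2: "inj_on f2 (EF - X)"
    and f2': "\<forall>e\<in>EF - X. f2 e \<in> {h \<in> H. \<phi> ` e \<subseteq> h} - f1 ` X"
    by (elim exE conjE) (rule that)
  define f where "f = (\<lambda>e. if e \<in> X then f1 e else f2 e)"
  have "f1 ` X \<inter> f2 ` (EF - X) = {}" using f2' by blast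
  then have "inj_on f (X \<union> (EF - X))"
    unfolding f_def using inj1 f2 by (intro inj_on_disjoint_Un)
  then have "inj_on f EF" using X by (simp add: Un_absorb1)
  moreover have "f e \<in> H \<and> \<phi> ` e \<subseteq> f e" if "e \<in> EF" for e
  proof (cases "e \<in> X")
    case True
    then show ?thesis using S(2)[of "\<phi> ` e"] by (simp add: f_def f1_def X_def)
  next
    case False
    then show ?thesis using f2' that by (simp add: f_def)
  qed
  ultimately have "contains_berge {0..<n} H VF EF"
    unfolding contains_berge_def using \<phi> by blast
  then show False using berge_free by blast
qed

lemma F_free_heavy_Un:
  assumes "S \<subseteq> light" "inj_on c S" "\<And>e. e \<in> S \<Longrightarrow> e \<subseteq> c e \<and> c e \<in> H"
  shows "F_free n VF EF (heavy \<union> S)"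
  using no_copy[OF assms(2,3)] assms(1) lightD
  unfolding F_free_def is_graph_def by (auto simp: heavy_def)

lemma F_free_heavy: "F_free n VF EF heavy"
  using F_free_heavy_Un[of "{}"] by simp

text \<open>Any injection of \<open>VF\<close> into a heavy clique would be a copy of
  \<open>F\<close> in the heavy graph.\<close>

lemma card_heavy_clique:
  assumes Q: "Q \<subseteq> {0..<n}" "\<And>e. e \<subseteq> Q \<Longrightarrow> card e = 2 \<Longrightarrow> e \<in> heavy"
  shows "card Q < card VF"
proof (rule ccontr)
  assume "\<not> card Q < card VF"
  moreover have "finite VF" "finite Q" using graph Q finite_subset by (auto simp: is_graph_def)
  ultimately obtain \<phi> where \<phi>: "\<phi> ` VF \<subseteq> Q" "inj_on \<phi> VF"
    using card_le_inj[of VF Q] by auto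
  have "\<phi> ` e \<in> heavy" if "e \<in> EF" for e
  proof (rule Q(2))
    have e: "e \<subseteq> VF" "card e = 2" using graph that by (auto simp: is_graph_def)
    then show "\<phi> ` e \<subseteq> Q" "card (\<phi> ` e) = 2"
      using \<phi> card_image inj_on_subset by (blast, metis)
  qed
  then have "contains_copy {0..<n} heavy VF EF"
    unfolding contains_copy_def using \<phi> Q(1) by blast
  then show False using F_free_heavy by (simp add: F_free_def)
qed

text \<open>Since \<open>ex m\<close> speaks of graphs on \<open>{0..<m}\<close>, the pairs are
  pulled back along a bijection \<open>b\<close> onto \<open>M\<close>. A copy of \<open>F\<close>
  there would be pushed forward by \<open>b\<close> to one excluded by
  \<open>no_copy\<close>.\<close>

lemma card_rainbow_light:
  assumes M: "M \<subseteq> {0..<n}" "card M = m"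
    and S: "S \<subseteq> light" "\<And>e. e \<in> S \<Longrightarrow> e \<subseteq> M"
    and c: "inj_on c S" "\<And>e. e \<in> S \<Longrightarrow> e \<subseteq> c e \<and> c e \<in> H"
  shows "card S \<le> ex m VF EF"
proof -
  have "finite M" using M finite_subset by blast
  then obtain b where b: "bij_betw b {0..<m} M" using M ex_bij_betw_nat_finite by blast
  define E where "E = {e. e \<subseteq> {0..<m} \<and> b ` e \<in> S}"
  have inj: "inj_on ((`) b) (Pow {0..<m})"
    using b by (simp add: bij_betw_def inj_on_image_Pow)
  have "S = (`) b ` E"
  proof safe
    fix s assume s: "s \<in> S"
    then have "s \<subseteq> b ` {0..<m}" using S b by (auto simp: bij_betw_def)
    then obtain d where "d \<subseteq> {0..<m}" "s = b ` d" by (meson subset_imageE)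
    then show "s \<in> (`) b ` E" using s by (auto simp: E_def)
  qed (auto simp: E_def)
  moreover have "inj_on ((`) b) E" by (rule inj_on_subset[OF inj]) (auto simp: E_def)
  ultimately have "card S = card E" by (metis card_image)
  moreover have "F_free m VF EF E"
    unfolding F_free_def is_graph_def
  proof (intro conjI ballI notI)
    fix e assume e: "e \<in> E"
    then have "card (b ` e) = 2" using S lightD by (auto simp: E_def)
    moreover have "inj_on b e" using b e by (auto simp: E_def bij_betw_def intro: inj_on_subset)
    ultimately show "card e = 2" by (simp add: card_image)
  next
    assume "contains_copy {0..<m} E VF EF"
    then obtain \<phi> where \<phi>: "inj_on \<phi> VF" "\<phi> ` VF \<subseteq> {0..<m}" "\<forall>e\<in>EF. \<phi> ` e \<in> E"
      unfolding contains_copy_def by blast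
    have "inj_on (b \<circ> \<phi>) VF"
      using \<phi> b by (intro comp_inj_on) (auto simp: bij_betw_def intro: inj_on_subset)
    moreover have "b ` \<phi> ` VF \<subseteq> b ` {0..<m}" using \<phi>(2) by (rule image_mono)
    then have "(b \<circ> \<phi>) ` VF \<subseteq> {0..<n}" using b M by (auto simp: bij_betw_def image_comp)
    moreover have "\<forall>e\<in>EF. (b \<circ> \<phi>) ` e \<in> heavy \<union> S" using \<phi> by (auto simp: E_def image_comp)
    ultimately have "contains_copy {0..<n} (heavy \<union> S) VF EF"
      unfolding contains_copy_def by blast
    then show False using no_copy[OF c] by blast
  qed (auto simp: E_def)
  ultimately show ?thesis using card_le_ex by metis
qed

text \<open>The sampling bound applies with each light pair coloured by one hyperedge containing it;
  rainbow samples are bounded by \<open>card_rainbow_light\<close>.\<close>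

lemma card_light_le:
  assumes m: "3 \<le> m" "m \<le> n"
  shows "real (card light) \<le> real (ex m VF EF) / (real m * (real m - 1)) * (real n * (real n - 1))
    + 3 * real (m choose 2) * real (r choose 2) * real m * real n"
proof -
  have "\<forall>e\<in>light. \<exists>h. h \<in> H \<and> e \<subseteq> h" by (auto simp: light_def)
  then obtain c where c: "\<And>e. e \<in> light \<Longrightarrow> c e \<in> H \<and> e \<subseteq> c e" by metis
  show ?thesis
  proof (rule card_le_of_rainbow_samples[where V = "{0..<n}" and c = c, OF _ _ m])
    show "e \<subseteq> {0..<n} \<and> card e = 2 \<and> e \<subseteq> c e \<and> finite (c e) \<and> card (c e) = r" if "e \<in> light" for e
      using lightD c hyperedge that by blast
    show "card {e \<in> light. e \<subseteq> M} \<le> ex m VF EF"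
      if "M \<subseteq> {0..<n}" "card M = m" "inj_on c {e \<in> light. e \<subseteq> M}" for M
      using that c by (intro card_rainbow_light[where M = M and c = c]) auto
  qed auto
qed

section \<open>Three kinds of hyperedges\<close>

definition heavy_complete :: "nat set set" where
  "heavy_complete = {h \<in> H. \<forall>e. e \<subseteq> h \<and> card e = 2 \<longrightarrow> e \<in> heavy}"

text \<open>A two-edge heavy path in \<open>h\<close> with middle \<open>w\<close> and light end
  pair \<open>p\<close>: precisely a failure of transitivity for heaviness inside a
  hyperedge.\<close>

definition cherry :: "nat set \<Rightarrow> nat set \<Rightarrow> nat \<Rightarrow> bool" where
  "cherry h p w \<longleftrightarrow> p \<in> light \<and> p \<subseteq> h \<and> w \<in> h \<and> w \<notin> p \<and> (\<forall>u\<in>p. {u, w} \<in> heavy)"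

definition cherried :: "nat set set" where
  "cherried = {h \<in> H. \<exists>p w. cherry h p w}"

lemma card_heavy_complete: "card heavy_complete \<le> ex_gen n (K_vert r) (K_edges r) VF EF"
proof -
  have "finite heavy" by (auto simp: heavy_def intro: finite_subset[of _ "Pow {0..<n}"])
  then have "card heavy_complete \<le> num_copies (K_vert r) (K_edges r) {0..<n} heavy"
    using hyperedge by (intro card_cliques_le_num_copies) (auto simp: heavy_complete_def)
  then show ?thesis using num_copies_le_ex_gen[OF F_free_heavy] le_trans by blast
qed

text \<open>Joining one light pair per cherried hyperedge to the heavy graph keeps it \<open>F\<close>-free, and each
  of these pairs closes a triangle in which it is the only light pair.\<close>

lemma card_cherried:
  "card cherried \<le> (card EF - 1) * ex_gen n (K_vert 3) (K_edges 3) VF EF"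
proof -
  have "\<forall>h\<in>cherried. \<exists>p. \<exists>w. cherry h p w" by (auto simp: cherried_def)
  then obtain p where p: "\<And>h. h \<in> cherried \<Longrightarrow> \<exists>w. cherry h (p h) w" by metis
  define P where "P = p ` cherried"
  have fin: "finite cherried" "finite P" using finite_H by (auto simp: cherried_def P_def)
  have PL: "P \<subseteq> light" using p by (auto simp: P_def cherry_def)
  \<comment> \<open>Choosing for each pair a hyperedge that selected it makes the representatives
    distinct, because an inverse of \<open>p\<close> on its image is injective.\<close>
  define c where "c = inv_into cherried p"
  have c: "c e \<in> cherried \<and> p (c e) = e" if "e \<in> P" for e
    using that by (auto simp: c_def P_def inv_into_into f_inv_into_f)
  have "inj_on c P" unfolding c_def P_def by (rule inj_on_inv_into) simp
  moreover have "e \<subseteq> c e \<and> c e \<in> H" if "e \<in> P" for e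
    using c[OF that] p[of "c e"] by (auto simp: cherry_def cherried_def)
  ultimately have G: "F_free n VF EF (heavy \<union> P)"
    using PL by (intro F_free_heavy_Un) auto

  have "\<forall>e\<in>P. \<exists>w. cherry (c e) e w" using p c by metis
  then obtain w where w: "\<And>e. e \<in> P \<Longrightarrow> cherry (c e) e (w e)" by metis
  have tri: "e' \<in> heavy \<or> e' = e" if "e \<in> P" "e' \<subseteq> insert (w e) e" "card e' = 2" for e e'
  proof (cases "w e \<in> e'")
    case True
    then obtain u where "e' = {u, w e}" "u \<noteq> w e"
      using \<open>card e' = 2\<close> by (auto simp: card_2_iff)
    then show ?thesis using w[OF \<open>e \<in> P\<close>] that by (auto simp: cherry_def)
  next
    case False
    then have "e' \<subseteq> e" using that by auto
    moreover have "card e = 2" "finite e"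
      using PL lightD \<open>e \<in> P\<close> finite_subset by blast+
    ultimately show ?thesis using card_subset_eq that by metis
  qed
  \<comment> \<open>If two triangles coincide, \<open>e'\<close> is a light pair in the triangle
    over \<open>e\<close>, whose only light pair is \<open>e\<close>.\<close>
  have "inj_on (\<lambda>e. insert (w e) e) P"
  proof (rule inj_onI)
    fix e e' assume e: "e \<in> P" "e' \<in> P" "insert (w e) e = insert (w e') e'"
    then have "e' \<in> light" "e' \<subseteq> insert (w e) e" using PL by auto
    then show "e = e'" using tri[OF e(1), of e'] by (auto simp: light_def)
  qed
  then have "card P = card ((\<lambda>e. insert (w e) e) ` P)" by (simp add: card_image)
  also have "\<dots> \<le> num_copies (K_vert 3) (K_edges 3) {0..<n} (heavy \<union> P)"
  proof (rule card_cliques_le_num_copies)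
    show "finite (heavy \<union> P)"
      using fin by (auto simp: heavy_def intro: finite_subset[of _ "Pow {0..<n}"])
    fix t assume "t \<in> (\<lambda>e. insert (w e) e) ` P"
    then obtain e where e: "e \<in> P" "t = insert (w e) e" by auto
    have "e \<subseteq> {0..<n}" "card e = 2" "finite e" using PL lightD e finite_subset by blast+
    moreover have "c e \<in> H" using c[OF e(1)] by (simp add: cherried_def)
    then have "w e \<notin> e" "w e < n"
      using w[OF e(1)] hyperedge[of "c e"] by (auto simp: cherry_def)
    ultimately show "t \<subseteq> {0..<n} \<and> card t = 3 \<and> (\<forall>e. e \<subseteq> t \<and> card e = 2 \<longrightarrow> e \<in> heavy \<union> P)"
      using tri[OF e(1)] e by auto
  qed simp
  also have "\<dots> \<le> ex_gen n (K_vert 3) (K_edges 3) VF EF"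
    by (rule num_copies_le_ex_gen[OF G])
  finally have cP: "card P \<le> ex_gen n (K_vert 3) (K_edges 3) VF EF" .

  \<comment> \<open>Several hyperedges may select the same pair, but being light it lies in at most
    \<open>card EF - 1\<close> of them.\<close>
  have "1 * card cherried \<le> (card EF - 1) * card P"
  proof (rule double_counting[OF fin, where R = "\<lambda>h e. e \<subseteq> h"])
    fix h assume h: "h \<in> cherried"
    then have "p h \<in> {e \<in> P. e \<subseteq> h}" using p by (auto simp: P_def cherry_def)
    then have "card {e \<in> P. e \<subseteq> h} > 0" using fin(2) by (subst card_gt_0_iff) auto
    then show "1 \<le> card {e \<in> P. e \<subseteq> h}" by simp
  next
    fix e assume "e \<in> P"
    have "card {h \<in> cherried. e \<subseteq> h} \<le> card {h \<in> H. e \<subseteq> h}"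
      using finite_H by (intro card_mono) (auto simp: cherried_def)
    also have "\<dots> < card EF" using lightD PL \<open>e \<in> P\<close> by blast
    finally show "card {h \<in> cherried. e \<subseteq> h} \<le> card EF - 1" by simp
  qed
  also have "\<dots> \<le> (card EF - 1) * ex_gen n (K_vert 3) (K_edges 3) VF EF"
    using cP by simp
  finally show ?thesis by simp
qed

text \<open>Without a cherry, being equal or forming a heavy pair is an equivalence relation on \<open>h\<close>.\<close>

lemma card_light_pairs:
  assumes h: "h \<in> H - heavy_complete - cherried" and VF: "2 \<le> card VF"
    and k: "k = min (r - 1) (card VF - 1)"
  shows "k * (r - k) \<le> card {e \<in> light. e \<subseteq> h}"
proof -
  have hH: "h \<in> H" and fin: "finite h" and cr: "card h = r" and hn: "h \<subseteq> {0..<n}"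
    using h hyperedge by auto
  define Q where "Q = (\<lambda>u v. u = v \<or> {u, v} \<in> heavy)"
  have trans: "Q u w" if "u \<in> h" "v \<in> h" "w \<in> h" "Q u v" "Q v w" for u v w
  proof (rule ccontr)
    assume nQ: "\<not> Q u w"
    then have "{u, w} \<in> light" using heavy_or_light[OF hH, of "{u, w}"] that by (auto simp: Q_def)
    moreover have "v \<noteq> u" "v \<noteq> w" using nQ that by auto
    ultimately have "cherry h {u, w} v"
      using that by (auto simp: cherry_def Q_def insert_commute)
    then show False using h by (auto simp: cherried_def)
  qed
  \<comment> \<open>The class of \<open>u\<close> is a heavy clique. It has fewer than
    \<open>card VF\<close> vertices by \<open>card_heavy_clique\<close>, and it is not all of
    \<open>h\<close> because \<open>h\<close> is not in \<open>heavy_complete\<close>; these give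
    the two terms of the minimum \<open>k\<close>.\<close>
  have small: "card {v \<in> h. Q u v} \<le> k" if u: "u \<in> h" for u
  proof -
    let ?A = "{v \<in> h. Q u v}"
    have sub: "Q a b" if "a \<in> ?A" "b \<in> ?A" for a b
      using trans[of a u b] that u by (auto simp: Q_def insert_commute)
    have clique: "e \<in> heavy" if "e \<subseteq> ?A" "card e = 2" for e
    proof -
      obtain a b where "e = {a, b}" "a \<noteq> b" using \<open>card e = 2\<close> by (auto simp: card_2_iff)
      then show ?thesis using sub[of a b] that by (auto simp: Q_def)
    qed
    then have "card ?A < card VF" using hn by (intro card_heavy_clique) auto
    moreover have "?A \<noteq> h"
      using clique h unfolding heavy_complete_def by blast
    then have "card ?A < r" using fin cr by (metis (no_types, lifting) mem_Collect_eq psubsetI psubset_card_mono subsetI)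
    ultimately show ?thesis unfolding k by (intro min.boundedI; linarith)
  qed
  have "k * (r - k) \<le> card {e \<in> light. e \<subseteq> h \<and> card e = 2}"
  proof (rule card_pairs_outside_classes[where Q = Q, OF fin cr _ trans _ _ small])
    show "{u, v} \<in> light" if "u \<in> h" "v \<in> h" "\<not> Q u v" for u v
      using heavy_or_light[OF hH, of "{u, v}"] that by (auto simp: Q_def)
  qed (auto simp: Q_def insert_commute k)
  also have "{e \<in> light. e \<subseteq> h \<and> card e = 2} = {e \<in> light. e \<subseteq> h}" by (auto simp: light_def)
  finally show ?thesis .
qed

lemma card_le_light:
  assumes VF: "2 \<le> card VF" and "2 \<le> r" and EF: "0 < card EF"
    and k: "k = min (r - 1) (card VF - 1)"
  shows "real (card H) \<le> (real (card EF) - 1) * real (ex_gen n (K_vert 3) (K_edges 3) VF EF)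
    + real (ex_gen n (K_vert r) (K_edges r) VF EF)
    + (real (card EF) - 1) * real (card light) / (real k * real (r - k))"
proof -
  let ?R = "H - heavy_complete - cherried"
  have "k * (r - k) * card ?R \<le> (card EF - 1) * card light"
  proof (rule double_counting[where R = "\<lambda>h e. e \<subseteq> h"])
    fix e assume "e \<in> light"
    have "card {h \<in> ?R. e \<subseteq> h} \<le> card {h \<in> H. e \<subseteq> h}"
      using finite_H by (intro card_mono) auto
    also have "\<dots> < card EF" using lightD \<open>e \<in> light\<close> by blast
    finally show "card {h \<in> ?R. e \<subseteq> h} \<le> card EF - 1" by simp
  qed (use finite_H finite_light card_light_pairs VF k in auto)
  then have "real (k * (r - k) * card ?R) \<le> real ((card EF - 1) * card light)"
    by (rule of_nat_mono)
  moreover have "real (card EF - 1) = real (card EF) - 1" using EF by simp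
  ultimately have "real (card ?R) * (real k * real (r - k)) \<le> (real (card EF) - 1) * real (card light)"
    by (simp only: of_nat_mult mult_ac)
  \<comment> \<open>Both \<open>r\<close> and \<open>card VF\<close> are at least 2, so
    \<open>1 \<le> k \<le> r - 1\<close>.\<close>
  moreover have "0 < real k * real (r - k)" using assms by auto
  ultimately have R: "real (card ?R) \<le> (real (card EF) - 1) * real (card light) / (real k * real (r - k))"
    by (simp only: pos_le_divide_eq)
  have "H = heavy_complete \<union> cherried \<union> ?R" by (auto simp: heavy_complete_def cherried_def)
  then have "card H \<le> card heavy_complete + card cherried + card ?R"
    by (metis card_Un_le add_le_mono1 le_trans)
  also have "\<dots> \<le> ex_gen n (K_vert r) (K_edges r) VF EF
      + (card EF - 1) * ex_gen n (K_vert 3) (K_edges 3) VF EF + card ?R"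
    using card_heavy_complete card_cherried by simp
  finally have "real (card H) \<le> real (ex_gen n (K_vert r) (K_edges r) VF EF
      + (card EF - 1) * ex_gen n (K_vert 3) (K_edges 3) VF EF + card ?R)"
    by (rule of_nat_mono)
  then show ?thesis using R EF by (simp add: of_nat_diff)
qed

end

section \<open>Asymptotics\<close>

text \<open>The infimum of the densities is at most the density at \<open>n\<close>, so sampling at an \<open>m\<close> that
  nearly attains it makes any comparison of densities at different sizes unnecessary.\<close>

lemma card_light_asymptotic:
  fixes VF :: "'a set" and \<epsilon> :: real
  assumes "\<epsilon> > 0"
  shows "\<exists>N. \<forall>n\<ge>N. \<forall>H. berge_free_hypergraph VF EF n r H \<longrightarrow>
    real (card (berge_free_hypergraph.light EF n H)) \<le> real (ex n VF EF) + \<epsilon> * real n ^ 2"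
proof -
  define d where "d = (\<lambda>m. real (ex m VF EF) / (real m * (real m - 1)))"
  have bdd: "bdd_below (d ` {3..})"
    by (rule bdd_belowI[of _ 0]) (auto simp: d_def)
  have "Inf (d ` {3..}) < Inf (d ` {3..}) + \<epsilon> / 2" using assms by simp
  then obtain m where m: "3 \<le> m" "d m < Inf (d ` {3..}) + \<epsilon> / 2"
    using bdd by (subst (asm) cInf_less_iff) auto
  \<comment> \<open>With \<open>m\<close> fixed, \<open>K\<close> is a constant and the sampling
    error is \<open>K * n\<close>. The choice of \<open>N\<close> makes it at most half of the
    allowed error; the other half pays for \<open>d m\<close> exceeding the infimum.\<close>
  define K where "K = 3 * real (m choose 2) * real (r choose 2) * real m"
  define N where "N = max m (nat \<lceil>2 * K / \<epsilon>\<rceil>)"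
  show ?thesis
  proof (intro exI[of _ N] allI impI)
    fix n H assume n: "N \<le> n" and "berge_free_hypergraph VF EF n r H"
    then interpret berge_free_hypergraph VF EF n r H by simp
    have mn: "m \<le> n" "2 * K / \<epsilon> \<le> real n" using n by (auto simp: N_def)
    have pos: "real n * (real n - 1) > 0" using m mn by simp
    have "Inf (d ` {3..}) \<le> d n" using bdd m mn by (intro cInf_lower) auto
    then have dm: "d m \<le> d n + \<epsilon> / 2" using m by simp
    have "real (card light) \<le> d m * (real n * (real n - 1)) + K * real n"
      using card_light_le[OF m(1) mn(1)] by (simp add: d_def K_def)
    also have "d m * (real n * (real n - 1)) \<le> (d n + \<epsilon> / 2) * (real n * (real n - 1))"
      using dm pos by (intro mult_right_mono) auto
    also have "\<dots> = real (ex n VF EF) + \<epsilon> / 2 * (real n * (real n - 1))"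
    proof -
      have "d n = real (ex n VF EF) / (real n * (real n - 1))" by (simp add: d_def)
      then have "d n * (real n * (real n - 1)) = real (ex n VF EF)"
        using pos by (metis less_irrefl nonzero_eq_divide_eq)
      then show ?thesis by (simp only: distrib_right)
    qed
    also have "\<epsilon> / 2 * (real n * (real n - 1)) \<le> \<epsilon> / 2 * (real n * real n)"
      using assms by (intro mult_left_mono) auto
    also have "K * real n \<le> \<epsilon> / 2 * real n * real n"
      using mn(2) assms by (intro mult_right_mono) (auto simp: field_simps)
    finally show "real (card light) \<le> real (ex n VF EF) + \<epsilon> * real n ^ 2"
      by (simp add: power2_eq_square)
  qed
qed

text \<open>The first alternative accounts for the default value 0 inserted under the
  maximum.\<close>

lemma ex_berge_attained:
  "ex_berge r n VF EF = 0 \<or>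
    (\<exists>H. uniform_hypergraph r n H \<and> \<not> contains_berge {0..<n} H VF EF \<and> card H = ex_berge r n VF EF)"
proof -
  let ?A = "{card H | H. uniform_hypergraph r n H \<and> \<not> contains_berge {0..<n} H VF EF}"
  have "finite {H. uniform_hypergraph r n H}"
    by (rule finite_subset[of _ "Pow (Pow {0..<n})"]) (auto simp: uniform_hypergraph_def)
  then have "finite ?A" by simp
  then have "Max (insert 0 ?A) \<in> insert 0 ?A" by (intro Max_in) auto
  then show ?thesis unfolding ex_berge_def by auto
qed

text \<open>With no edges to map, an injection of \<open>VF\<close> alone is a copy, so no
  admissible host exists and each maximum takes its default value 0. In the theorem this neutralises
  the coefficient \<open>card EF - 1\<close>, which is then -1.\<close>

lemma edgeless_trivial:
  assumes "finite VF" "card VF \<le> n"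
  shows "ex_berge r n VF {} = 0" "ex n VF {} = 0" "ex_gen n VH EH VF {} = 0"
proof -
  obtain \<phi> where "inj_on \<phi> VF" "\<phi> ` VF \<subseteq> {0..<n}"
    using card_le_inj[of VF "{0..<n}"] assms by auto
  then have c: "contains_copy {0..<n} E VF {}" "contains_berge {0..<n} H VF {}" for E H
    by (auto simp: contains_copy_def contains_berge_def)
  show "ex_berge r n VF {} = 0" "ex n VF {} = 0" "ex_gen n VH EH VF {} = 0"
    by (simp_all add: ex_berge_def ex_def ex_gen_def F_free_def c)
qed

theorem theorem7:
  fixes VF :: "'a set" and EF :: "'a set set" and r :: nat
  assumes "is_graph VF EF" and "card VF \<ge> 2" and "r \<ge> 2"
  defines "k \<equiv> min (r - 1) (card VF - 1)"
  shows "\<exists>g :: nat \<Rightarrow> real. g \<in> o(\<lambda>n. real n ^ 2) \<and>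
    (\<forall>\<^sub>F n in at_top.
      real (ex_berge r n VF EF)
        \<le> (real (card EF) - 1) * real (ex_gen n (K_vert 3) (K_edges 3) VF EF)
          + real (ex_gen n (K_vert r) (K_edges r) VF EF)
          + (real (card EF) - 1) * real (ex n VF EF) / (real k * real (r - k))
          + g n)"
proof (cases "EF = {}")
  case True
  have fin: "finite VF" using assms(1) by (simp add: is_graph_def)
  have "\<forall>\<^sub>F n in at_top. real (ex_berge r n VF EF)
        \<le> (real (card EF) - 1) * real (ex_gen n (K_vert 3) (K_edges 3) VF EF)
          + real (ex_gen n (K_vert r) (K_edges r) VF EF)
          + (real (card EF) - 1) * real (ex n VF EF) / (real k * real (r - k)) + 0"
    by (rule eventually_mono[OF eventually_ge_at_top[of "card VF"]])
      (simp add: True edgeless_trivial fin)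
  then show ?thesis by (intro exI[of _ "\<lambda>_. 0"]) simp
next
  case False
  have "finite EF" using assms(1) by (auto simp: is_graph_def intro: finite_subset[of _ "Pow VF"])
  then have EF: "0 < card EF" using False by (simp add: card_gt_0_iff)
  define D where "D = real k * real (r - k)"
  have D: "D > 0" using assms by (auto simp: D_def k_def)
  define B where "B = (\<lambda>n. (real (card EF) - 1) * real (ex_gen n (K_vert 3) (K_edges 3) VF EF)
          + real (ex_gen n (K_vert r) (K_edges r) VF EF)
          + (real (card EF) - 1) * real (ex n VF EF) / D)"
  have B0: "B n \<ge> 0" for n using EF D by (auto simp: B_def)
  \<comment> \<open>Taking the excess over the bound, cut off at 0, makes the inequality immediate;
    what remains is that \<open>g\<close> is of smaller order than \<open>n^2\<close>.\<close>
  define g where "g = (\<lambda>n. max 0 (real (ex_berge r n VF EF) - B n))"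
  have "g \<in> o(\<lambda>n. real n ^ 2)"
  proof (rule landau_o.smallI)
    fix \<epsilon> :: real assume "\<epsilon> > 0"
    \<comment> \<open>The error for light pairs is later multiplied by
      \<open>(card EF - 1) / D\<close>, which this scaling brings to at most
      \<open>\<epsilon>\<close>.\<close>
    define \<delta> where "\<delta> = \<epsilon> * D / real (card EF)"
    have "\<delta> > 0" using \<open>\<epsilon> > 0\<close> D EF by (simp add: \<delta>_def)
    from card_light_asymptotic[OF this] obtain N where N:
      "\<And>n H. N \<le> n \<Longrightarrow> berge_free_hypergraph VF EF n r H \<Longrightarrow>
        real (card (berge_free_hypergraph.light EF n H)) \<le> real (ex n VF EF) + \<delta> * real n ^ 2"
      by blast
    have "real (ex_berge r n VF EF) \<le> B n + \<epsilon> * real n ^ 2" if "N \<le> n" for n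
      using ex_berge_attained[of r n VF EF]
    proof (elim disjE exE conjE)
      assume "ex_berge r n VF EF = 0"
      then show ?thesis using B0[of n] \<open>\<epsilon> > 0\<close> by simp
    next
      fix H assume H: "uniform_hypergraph r n H" "\<not> contains_berge {0..<n} H VF EF"
        and card: "card H = ex_berge r n VF EF"
      interpret berge_free_hypergraph VF EF n r H by unfold_locales (use assms H in auto)
      have "real (card H) \<le> (real (card EF) - 1) * real (ex_gen n (K_vert 3) (K_edges 3) VF EF)
          + real (ex_gen n (K_vert r) (K_edges r) VF EF)
          + (real (card EF) - 1) * real (card light) / D"
        unfolding D_def using card_le_light[OF assms(2,3) EF] by (simp add: k_def)
      also have "(real (card EF) - 1) * real (card light) / D
          \<le> (real (card EF) - 1) * (real (ex n VF EF) + \<delta> * real n ^ 2) / D"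
        using N[OF \<open>N \<le> n\<close>] D EF berge_free_hypergraph_axioms
        by (intro divide_right_mono mult_left_mono) auto
      also have "\<dots> = (real (card EF) - 1) * real (ex n VF EF) / D
          + (real (card EF) - 1) * \<delta> / D * real n ^ 2"
        by (simp add: diff_divide_distrib add_divide_distrib algebra_simps)
      also have "(real (card EF) - 1) * \<delta> / D * real n ^ 2 \<le> \<epsilon> * real n ^ 2"
        using D EF \<open>\<epsilon> > 0\<close> by (intro mult_right_mono) (auto simp: \<delta>_def field_simps)
      finally show ?thesis by (simp add: B_def card)
    qed
    then have "norm (g n) \<le> \<epsilon> * norm (real n ^ 2)" if "N \<le> n" for n
      using that \<open>\<epsilon> > 0\<close> by (simp add: g_def) force
    then show "\<forall>\<^sub>F n in at_top. norm (g n) \<le> \<epsilon> * norm (real n ^ 2)"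
      using eventually_at_top_linorder by blast
  qed
  moreover have "real (ex_berge r n VF EF) \<le> B n + g n" for n by (simp add: g_def)
  ultimately show ?thesis by (intro exI[of _ g]) (auto simp: B_def D_def)
qed

end
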